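(* Let $m\ge 1$ be an integer. For all integers $n\geq m$, $$\sum_{j=0}^{n-m} F_j^{(m)} F_{n-m-j}^{(m+1)}= F_n^{(m+1)} - F_n^{(m)}.$$
   Context: For each integer $m\ge 1$ the Fibonacci $m$-step numbers $F_n^{(m)}$ are defined by $F_n^{(m)}=0$ for $n=-(m-2),\ldots,0$ (with $F_0^{(1)}=0$ when $m=1$), $F_1^{(m)}=1$, and $F_n^{(m)}=\sum_{j=1}^m F_{n-j}^{(m)}$ for all $n\ge 2$. In particular $F_0^{(m)}=0$ for all $m\ge1$, and $F_n^{(1)}=1$ for all $n\ge 1$. *)

theory Defs
  imports Main
begin

(* For m \<ge> 1, "fibstep m n" is F_n^(m). The index n is an integer because the initial values
   and the recurrence involve F_n^(m) for n = -(m-2), ..., 0. The value 0 for n < -(m-2) is a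
   totality convention only: for n \<ge> 2 and 1 \<le> j \<le> m one has n - j \<ge> -(m-2). *)
function fibstep :: "nat \<Rightarrow> int \<Rightarrow> int" where
  "fibstep m n =
     (if n \<le> 0 then 0
      else if n = 1 then 1
      else (\<Sum>j=1..m. fibstep m (n - int j)))"
  by pat_completeness auto
termination
  by (relation "measure (\<lambda>(m, n). nat n)") auto

declare fibstep.simps [simp del]

end

theory Submission
  imports Defs "HOL-Computational_Algebra.Formal_Power_Series"
begin

text \<open>The identity is a relation between generating functions. Put
  \<open>P\<^sub>m = X + X\<^sup>2 + \<dots> + X^m\<close> and let \<open>G\<^sub>m\<close> be the generating function of the \<open>m\<close>-step numbers,
  so that the recurrence reads \<open>(1 - P\<^sub>m) G\<^sub>m = X\<close>. Heuristically,
  \<open>X / (1 - P\<^sub>m - X^(m + 1)) - X / (1 - P\<^sub>m)\<close> is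
  \<open>X * X^(m + 1) / ((1 - P\<^sub>m) (1 - P\<^sub>m - X^(m + 1)))\<close>, which is \<open>X^m G\<^sub>m G\<^sub>m\<^sub>+\<^sub>1\<close>. The factor
  \<open>X^m\<close> is the shift by \<open>m\<close> in the convolution, and the theorem compares coefficients.
  Division is avoided by working in the integral domain of integer power series, where
  a factor \<open>X\<close> may be cancelled.\<close>

definition fibstep_fps :: "nat \<Rightarrow> int fps" where
  "fibstep_fps m = Abs_fps (\<lambda>n. fibstep m (int n))"

lemma fibstep_nonpos: "n \<le> 0 \<Longrightarrow> fibstep m n = 0"
  by (simp add: fibstep.simps)

text \<open>Since \<open>fibstep\<close> vanishes at nonpositive arguments, the recurrence extends to all
  integers once a unit impulse is added at \<open>1\<close>; no case distinction on small arguments remains.\<close>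

lemma fibstep_recurrence:
  "fibstep m n = (if n = 1 then 1 else 0) + (\<Sum>j=1..m. fibstep m (n - int j))"
proof (cases "n \<le> 1")
  case True
  then have "(\<Sum>j=1..m. fibstep m (n - int j)) = 0"
    by (intro sum.neutral) (auto intro!: fibstep_nonpos)
  with True show ?thesis
    by (simp add: fibstep.simps[of m n])
next
  case False
  then show ?thesis
    by (simp add: fibstep.simps[of m n])
qed

lemma fibstep_fps_equation:
  "fibstep_fps m = fps_X + (\<Sum>j=1..m. fps_X ^ j) * fibstep_fps m"
proof (rule fps_ext)
  fix n
  have shift: "fps_nth (fps_X ^ j * fibstep_fps m) n = fibstep m (int n - int j)" for j
    by (auto simp: fps_X_power_mult_nth fibstep_fps_def of_nat_diff fibstep_nonpos)
  have "fps_nth (fibstep_fps m) n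
      = fps_nth fps_X n + (\<Sum>j=1..m. fps_nth (fps_X ^ j * fibstep_fps m) n)"
    unfolding shift using fibstep_recurrence[of m "int n"]
    by (simp add: fibstep_fps_def)
  then show "fps_nth (fibstep_fps m) n
      = fps_nth (fps_X + (\<Sum>j=1..m. fps_X ^ j) * fibstep_fps m) n"
    by (simp only: sum_distrib_right fps_sum_nth fps_add_nth)
qed

text \<open>Multiplying \<open>(1 - P\<^sub>m) (G\<^sub>m\<^sub>+\<^sub>1 - G\<^sub>m) = X^(m + 1) G\<^sub>m\<^sub>+\<^sub>1\<close> by \<open>G\<^sub>m\<close> turns the
  factor \<open>1 - P\<^sub>m\<close> into \<open>X\<close>, which then cancels.\<close>

lemma fibstep_fps_convolution:
  "fps_X ^ m * (fibstep_fps m * fibstep_fps (m + 1)) = fibstep_fps (m + 1) - fibstep_fps m"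
proof -
  define P :: "int fps" where "P = (\<Sum>j=1..m. fps_X ^ j)"
  define A where "A = fibstep_fps m"
  define B where "B = fibstep_fps (m + 1)"
  have A: "(1 - P) * A = fps_X"
    using fibstep_fps_equation[of m] by (simp add: P_def A_def algebra_simps)
  have B: "(1 - P) * B = fps_X + fps_X ^ (m + 1) * B"
    using fibstep_fps_equation[of "m + 1"] by (simp add: P_def B_def algebra_simps)
  have "fps_X * (B - A) = A * ((1 - P) * B - (1 - P) * A)"
    unfolding A[symmetric] by (simp add: algebra_simps)
  also have "\<dots> = fps_X * (fps_X ^ m * (A * B))"
    unfolding A B by (simp add: algebra_simps)
  finally show ?thesis
    by (simp add: A_def B_def)
qed

theorem theorem2p1:
  fixes m :: nat and n :: int
  assumes "m \<ge> 1" and "n \<ge> int m"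
  shows "(\<Sum>j=0..n - int m. fibstep m j * fibstep (m + 1) (n - int m - j))
           = fibstep (m + 1) n - fibstep m n"
proof -
  obtain k where k: "n = int m + int k"
    using assms(2) zle_iff_zadd by blast
  have "(\<Sum>j=0..n - int m. fibstep m j * fibstep (m + 1) (n - int m - j))
      = (\<Sum>i=0..k. fibstep m (int i) * fibstep (m + 1) (int (k - i)))"
    by (rule sum.reindex_bij_witness[of _ int nat]) (auto simp: k of_nat_diff)
  also have "\<dots> = fps_nth (fps_X ^ m * (fibstep_fps m * fibstep_fps (m + 1))) (m + k)"
    unfolding fps_X_power_mult_nth by (simp add: fps_mult_nth fibstep_fps_def)
  also have "\<dots> = fibstep (m + 1) n - fibstep m n"
    unfolding fibstep_fps_convolution by (simp add: fibstep_fps_def k)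
  finally show ?thesis .
qed

end
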